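(* Let $X$ be a diffeological space and let $x\in X$. If $X$ is smoothly regular at $x$, then there is an isomorphism of real vector spaces $$\hat{\mathbb{T}}^R_x(X)\cong \hat T^R_x(X)$$ between the global right tangent space and the right tangent space of $X$ at $x$.
   Context: A Euclidean open set is an open subset of $\mathbb{R}^n$ for some $n\ge 0$. A parametrization of a set $X$ is a map $U\to X$ with $U$ a Euclidean open set. A diffeology on $X$ is a set of parametrizations, called plots, such that: every constant parametrization is a plot; a parametrization $U\to X$ that restricts to a plot on each member of some open cover of $U$ is a plot; if $p\colon U\to X$ is a plot and $f\colon V\to U$ is a $C^\infty$ map from a Euclidean open set, then $p\circ f$ is a plot. A diffeological space is a set with a diffeology. A map $f\colon X\to Y$ of diffeological spaces is smooth if $f\circ p$ is a plot of $Y$ for every plot $p$ of $X$. Euclidean open sets carry the diffeology of all $C^\infty$ parametrizations. The $D$-topology on $X$ is the largest topology making all plots continuous; its open sets are called $D$-open. A subset $Y\subset X$ carries the subdiffeology: the parametrizations of $Y$ that are plots of $X$. $X$ is smoothly regular at $x$ (for its $D$-topology) if for every $D$-open neighbourhood $U$ of $x$ there is a smooth map $\lambda\colon X\to\mathbb{R}$ with $\lambda(x)=1$ and $\lambda(y)=0$ for all $y\notin U$. $G(X,x)$ denotes the $\mathbb{R}$-algebra of germs $[g,B]$ at $x$ of smooth functions $g\colon B\to\mathbb{R}$, $B$ a $D$-open neighbourhood of $x$ (two functions are identified if they agree on a $D$-open neighbourhood of $x$). The right tangent space $\hat T^R_x(X)$ is the vector space of linear maps $D\colon G(X,x)\to\mathbb{R}$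 with $D([g,B]\,[h,B'])=g(x)D([h,B'])+h(x)D([g,B])$. The global right tangent space $\hat{\mathbb{T}}^R_x(X)$ is the vector space of linear maps $D\colon C^\infty(X,\mathbb{R})\to\mathbb{R}$ with $D(gh)=g(x)D(h)+h(x)D(g)$, where $C^\infty(X,\mathbb{R})$ is the algebra of smooth functions on $X$. *)

theory Defs
  imports "HOL-Analysis.Analysis" "HOL-Algebra.Module"
begin

section \<open>Smooth maps between Euclidean open sets\<close>

text \<open>The space \<open>Euclidean_space n\<close> of the library consists of the sequences
  \<open>x :: nat \<Rightarrow> real\<close> with \<open>x i = 0\<close> for \<open>i \<ge> n\<close>, so all dimensions \<open>n \<ge> 0\<close> live in one type.
  A Euclidean open set is a set that is open in \<open>Euclidean_space n\<close>, taken together with \<open>n\<close>.\<close>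

definition partial_deriv :: "nat \<Rightarrow> ((nat \<Rightarrow> real) \<Rightarrow> real) \<Rightarrow> (nat \<Rightarrow> real) \<Rightarrow> real"
  where "partial_deriv i f x = deriv (\<lambda>t. f (x(i := t))) (x i)"

text \<open>Only the values of \<open>f\<close> on the open set \<open>U\<close> matter in the following definition.\<close>

primrec C_k_on :: "nat \<Rightarrow> nat \<Rightarrow> (nat \<Rightarrow> real) set \<Rightarrow> ((nat \<Rightarrow> real) \<Rightarrow> real) \<Rightarrow> bool"
  where
    "C_k_on n 0 U f \<longleftrightarrow>
       continuous_map (subtopology (Euclidean_space n) U) euclideanreal f"
  | "C_k_on n (Suc k) U f \<longleftrightarrow>
       continuous_map (subtopology (Euclidean_space n) U) euclideanreal f \<and>
       (\<forall>i<n. (\<forall>x\<in>U. (\<lambda>t. f (x(i := t))) differentiable (at (x i))) \<and>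
              C_k_on n k U (partial_deriv i f))"

definition C_infinity_on :: "nat \<Rightarrow> (nat \<Rightarrow> real) set \<Rightarrow> ((nat \<Rightarrow> real) \<Rightarrow> real) \<Rightarrow> bool"
  where "C_infinity_on n U f \<longleftrightarrow> (\<forall>k. C_k_on n k U f)"

text \<open>For a map into a subset of \<open>Euclidean_space n\<close> the coordinates from \<open>n\<close> on vanish.\<close>

definition C_infinity_map ::
    "nat \<Rightarrow> (nat \<Rightarrow> real) set \<Rightarrow> nat \<Rightarrow> (nat \<Rightarrow> real) set \<Rightarrow> ((nat \<Rightarrow> real) \<Rightarrow> (nat \<Rightarrow> real)) \<Rightarrow> bool"
  where "C_infinity_map m V n U f \<longleftrightarrow> f \<in> V \<rightarrow> U \<and> (\<forall>i<n. C_infinity_on m V (\<lambda>v. f v i))"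


section \<open>Diffeological spaces\<close>

text \<open>A parametrization \<open>U \<rightarrow> X\<close> is recorded as \<open>(n, U, p)\<close> with \<open>p\<close> extensional on \<open>U\<close>,
  so that equality of triples is equality of maps.\<close>

type_synonym 'a parametrization = "nat \<times> (nat \<Rightarrow> real) set \<times> ((nat \<Rightarrow> real) \<Rightarrow> 'a)"

definition parametrizations :: "'a set \<Rightarrow> 'a parametrization set"
  where "parametrizations X = {(n, U, p). openin (Euclidean_space n) U \<and> p \<in> U \<rightarrow>\<^sub>E X}"

locale diffeological_space =
  fixes X :: "'a set" and P :: "'a parametrization set"
  assumes plots_subset: "P \<subseteq> parametrizations X"
    and constant_plot:
      "\<And>n U c. openin (Euclidean_space n) U \<Longrightarrow> c \<in> X \<Longrightarrow> (n, U, \<lambda>u\<in>U. c) \<in> P"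
    and local_plot:
      "\<And>n U p \<V>. (n, U, p) \<in> parametrizations X \<Longrightarrow>
         (\<And>V. V \<in> \<V> \<Longrightarrow> openin (Euclidean_space n) V) \<Longrightarrow> \<Union>\<V> = U \<Longrightarrow>
         (\<And>V. V \<in> \<V> \<Longrightarrow> (n, V, restrict p V) \<in> P) \<Longrightarrow> (n, U, p) \<in> P"
    and plot_compose:
      "\<And>n U p m V f. (n, U, p) \<in> P \<Longrightarrow> openin (Euclidean_space m) V \<Longrightarrow>
         C_infinity_map m V n U f \<Longrightarrow> (m, V, compose V p f) \<in> P"

definition smooth_maps ::
    "'a set \<Rightarrow> 'a parametrization set \<Rightarrow> 'b set \<Rightarrow> 'b parametrization set \<Rightarrow> ('a \<Rightarrow> 'b) set"
  where "smooth_maps X P Y Q =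
    {f \<in> X \<rightarrow>\<^sub>E Y. \<forall>(n, U, p)\<in>P. (n, U, compose U f p) \<in> Q}"

text \<open>The diffeology of all smooth parametrizations of the line, with the type \<open>real\<close> in place of
  \<open>Euclidean_space 1\<close>.\<close>

definition real_plots :: "real parametrization set"
  where "real_plots = {(n, U, q) \<in> parametrizations UNIV. C_infinity_on n U q}"

abbreviation smooth_functions :: "'a set \<Rightarrow> 'a parametrization set \<Rightarrow> ('a \<Rightarrow> real) set"
  where "smooth_functions X P \<equiv> smooth_maps X P UNIV real_plots"

definition subdiffeology :: "'a parametrization set \<Rightarrow> 'a set \<Rightarrow> 'a parametrization set"
  where "subdiffeology P Y = P \<inter> parametrizations Y"

definition D_topology :: "'a set \<Rightarrow> 'a parametrization set \<Rightarrow> 'a topology"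
  where "D_topology X P =
    topology (\<lambda>A. A \<subseteq> X \<and> (\<forall>(n, U, p)\<in>P. openin (Euclidean_space n) {u \<in> U. p u \<in> A}))"

lemma openin_D_topology:
  assumes "P \<subseteq> parametrizations X"
  shows "openin (D_topology X P) A \<longleftrightarrow>
    A \<subseteq> X \<and> (\<forall>(n, U, p)\<in>P. openin (Euclidean_space n) {u \<in> U. p u \<in> A})"
proof -
  let ?O = "\<lambda>A. A \<subseteq> X \<and> (\<forall>(n, U, p)\<in>P. openin (Euclidean_space n) {u \<in> U. p u \<in> A})"
  have "?O (S \<inter> T)" if "?O S" "?O T" for S T
  proof -
    have "openin (Euclidean_space n) {u \<in> U. p u \<in> S \<inter> T}" if "(n, U, p) \<in> P" for n U p
    proof -
      have "openin (Euclidean_space n) ({u \<in> U. p u \<in> S} \<inter> {u \<in> U. p u \<in> T})"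
        using \<open>?O S\<close> \<open>?O T\<close> that by (intro openin_Int) auto
      moreover have "{u \<in> U. p u \<in> S} \<inter> {u \<in> U. p u \<in> T} = {u \<in> U. p u \<in> S \<inter> T}"
        by auto
      ultimately show ?thesis by simp
    qed
    then show ?thesis using that by auto
  qed
  moreover have "?O (\<Union>\<K>)" if K: "\<forall>K\<in>\<K>. ?O K" for \<K>
  proof -
    have "openin (Euclidean_space n) {u \<in> U. p u \<in> \<Union>\<K>}" if "(n, U, p) \<in> P" for n U p
    proof -
      have "openin (Euclidean_space n) (\<Union>K\<in>\<K>. {u \<in> U. p u \<in> K})"
        using K that by (intro openin_Union) auto
      moreover have "(\<Union>K\<in>\<K>. {u \<in> U. p u \<in> K}) = {u \<in> U. p u \<in> \<Union>\<K>}"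
        by auto
      ultimately show ?thesis by simp
    qed
    moreover have "\<Union>\<K> \<subseteq> X" using K by blast
    ultimately show ?thesis by auto
  qed
  ultimately have "istopology ?O"
    unfolding istopology_def by blast
  then show ?thesis
    by (simp add: D_topology_def topology_inverse')
qed

lemma topspace_D_topology:
  assumes "P \<subseteq> parametrizations X"
  shows "topspace (D_topology X P) = X"
proof -
  have "openin (Euclidean_space n) {u \<in> U. p u \<in> X}" if "(n, U, p) \<in> P" for n U p
  proof -
    have "openin (Euclidean_space n) U" and p: "p \<in> U \<rightarrow>\<^sub>E X"
      using that assms by (auto simp: parametrizations_def)
    moreover have "{u \<in> U. p u \<in> X} = U"
      using p by auto
    ultimately show ?thesis by simp
  qed
  then have "openin (D_topology X P) X"
    by (auto simp: openin_D_topology [OF assms])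
  moreover have "topspace (D_topology X P) \<subseteq> X"
    using openin_topspace [of "D_topology X P"] openin_D_topology [OF assms] by blast
  ultimately show ?thesis
    by (simp add: openin_subset subset_antisym)
qed

text \<open>The D-topology makes all plots continuous and is the largest topology on \<open>X\<close> doing so.\<close>

lemma continuous_map_plot_iff:
  assumes "openin (Euclidean_space n) U" and "p \<in> U \<rightarrow>\<^sub>E topspace T"
  shows "continuous_map (subtopology (Euclidean_space n) U) T p \<longleftrightarrow>
    (\<forall>A. openin T A \<longrightarrow> openin (Euclidean_space n) {u \<in> U. p u \<in> A})"
proof -
  have top: "topspace (subtopology (Euclidean_space n) U) = U"
    using openin_subset [OF assms(1)] by (simp add: inf.absorb2)
  have "openin (subtopology (Euclidean_space n) U) {u \<in> U. p u \<in> A} \<longleftrightarrow>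
      openin (Euclidean_space n) {u \<in> U. p u \<in> A}" for A
    using openin_open_subtopology [OF assms(1)] by auto
  moreover have "p \<in> U \<rightarrow> topspace T" using assms(2) by auto
  ultimately show ?thesis
    by (simp only: continuous_map_def top) simp
qed

lemma D_topology_continuous_plot:
  assumes "P \<subseteq> parametrizations X" and "(n, U, p) \<in> P"
  shows "continuous_map (subtopology (Euclidean_space n) U) (D_topology X P) p"
proof -
  have "openin (Euclidean_space n) U" "p \<in> U \<rightarrow>\<^sub>E topspace (D_topology X P)"
    using assms topspace_D_topology [OF assms(1)] by (auto simp: parametrizations_def)
  moreover have "\<forall>A. openin (D_topology X P) A \<longrightarrow> openin (Euclidean_space n) {u \<in> U. p u \<in> A}"
    using openin_D_topology [OF assms(1)] assms(2) by auto
  ultimately show ?thesis by (simp add: continuous_map_plot_iff)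
qed

lemma D_topology_largest:
  assumes "P \<subseteq> parametrizations X" and "topspace T = X"
    and "\<And>n U p. (n, U, p) \<in> P \<Longrightarrow> continuous_map (subtopology (Euclidean_space n) U) T p"
    and "openin T A"
  shows "openin (D_topology X P) A"
proof -
  have "openin (Euclidean_space n) {u \<in> U. p u \<in> A}" if "(n, U, p) \<in> P" for n U p
  proof -
    have "openin (Euclidean_space n) U" "p \<in> U \<rightarrow>\<^sub>E topspace T"
      using that assms(1,2) by (auto simp: parametrizations_def)
    with assms(3) [OF that] assms(4) show ?thesis
      using continuous_map_plot_iff by blast
  qed
  moreover have "A \<subseteq> X" using openin_subset [OF assms(4)] assms(2) by simp
  ultimately show ?thesis
    using openin_D_topology [OF assms(1), of A] by auto
qed

definition smoothly_regular_at :: "'a set \<Rightarrow> 'a parametrization set \<Rightarrow> 'a \<Rightarrow> bool"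
  where "smoothly_regular_at X P x \<longleftrightarrow>
    (\<forall>U. openin (D_topology X P) U \<and> x \<in> U \<longrightarrow>
      (\<exists>l\<in>smooth_functions X P. l x = 1 \<and> (\<forall>y\<in>X - U. l y = 0)))"


section \<open>The algebras of smooth functions and of germs\<close>

definition smooth_algebra :: "'a set \<Rightarrow> 'a parametrization set \<Rightarrow> (real, 'a \<Rightarrow> real) module"
  where "smooth_algebra X P =
    \<lparr>carrier = smooth_functions X P,
     monoid.mult = (\<lambda>g h. \<lambda>y\<in>X. g y * h y), one = (\<lambda>y\<in>X. 1),
     zero = (\<lambda>y\<in>X. 0), add = (\<lambda>g h. \<lambda>y\<in>X. g y + h y),
     smult = (\<lambda>c g. \<lambda>y\<in>X. c * g y)\<rparr>"

definition local_functions ::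
    "'a set \<Rightarrow> 'a parametrization set \<Rightarrow> 'a \<Rightarrow> ('a set \<times> ('a \<Rightarrow> real)) set"
  where "local_functions X P x =
    {(B, g). openin (D_topology X P) B \<and> x \<in> B \<and> g \<in> smooth_functions B (subdiffeology P B)}"

definition germ_rel ::
    "'a set \<Rightarrow> 'a parametrization set \<Rightarrow> 'a \<Rightarrow> ('a set \<times> ('a \<Rightarrow> real)) rel"
  where "germ_rel X P x =
    {((B, g), (B', h)). (B, g) \<in> local_functions X P x \<and> (B', h) \<in> local_functions X P x \<and>
       (\<exists>W. openin (D_topology X P) W \<and> x \<in> W \<and> W \<subseteq> B \<inter> B' \<and> (\<forall>y\<in>W. g y = h y))}"

definition germ ::
    "'a set \<Rightarrow> 'a parametrization set \<Rightarrow> 'a \<Rightarrow> 'a set \<Rightarrow> ('a \<Rightarrow> real) \<Rightarrow> ('a set \<times> ('a \<Rightarrow> real)) set"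
  where "germ X P x B g = germ_rel X P x `` {(B, g)}"

text \<open>The operations on classes are the usual unions over representatives; they do not depend
  on the choice of these.\<close>

definition germ_algebra ::
    "'a set \<Rightarrow> 'a parametrization set \<Rightarrow> 'a \<Rightarrow> (real, ('a set \<times> ('a \<Rightarrow> real)) set) module"
  where "germ_algebra X P x =
    \<lparr>carrier = local_functions X P x // germ_rel X P x,
     monoid.mult = (\<lambda>a b. \<Union>(B, g)\<in>a. \<Union>(B', h)\<in>b. germ X P x (B \<inter> B') (\<lambda>y\<in>B \<inter> B'. g y * h y)),
     one = germ X P x X (\<lambda>y\<in>X. 1),
     zero = germ X P x X (\<lambda>y\<in>X. 0),
     add = (\<lambda>a b. \<Union>(B, g)\<in>a. \<Union>(B', h)\<in>b. germ X P x (B \<inter> B') (\<lambda>y\<in>B \<inter> B'. g y + h y)),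
     smult = (\<lambda>c a. \<Union>(B, g)\<in>a. germ X P x B (\<lambda>y\<in>B. c * g y))\<rparr>"

definition germ_value :: "'a \<Rightarrow> ('a set \<times> ('a \<Rightarrow> real)) set \<Rightarrow> real"
  where "germ_value x a = the_elem ((\<lambda>(B, g). g x) ` a)"


section \<open>Tangent spaces\<close>

definition real_ring :: "real ring"
  where "real_ring = \<lparr>carrier = UNIV, monoid.mult = (*), one = 1, zero = 0, add = (+)\<rparr>"

text \<open>The real vector space, with pointwise operations, of the linear maps \<open>D\<close> from an algebra
  \<open>A\<close> to the reals that satisfy the Leibniz rule relative to an evaluation \<open>ev\<close>. It is a
  HOL-Algebra module, whose ring multiplication and unit carry no information.\<close>

definition derivation_space :: "(real, 'g) module \<Rightarrow> ('g \<Rightarrow> real) \<Rightarrow> (real, 'g \<Rightarrow> real) module"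
  where "derivation_space A ev =
    \<lparr>carrier = {D \<in> carrier A \<rightarrow>\<^sub>E UNIV.
        (\<forall>a\<in>carrier A. \<forall>b\<in>carrier A. D (a \<oplus>\<^bsub>A\<^esub> b) = D a + D b) \<and>
        (\<forall>c. \<forall>a\<in>carrier A. D (c \<odot>\<^bsub>A\<^esub> a) = c * D a) \<and>
        (\<forall>a\<in>carrier A. \<forall>b\<in>carrier A. D (a \<otimes>\<^bsub>A\<^esub> b) = ev a * D b + ev b * D a)},
     monoid.mult = undefined, one = undefined,
     zero = (\<lambda>a\<in>carrier A. 0), add = (\<lambda>D E. \<lambda>a\<in>carrier A. D a + E a),
     smult = (\<lambda>c D. \<lambda>a\<in>carrier A. c * D a)\<rparr>"

definition right_tangent_space ::
    "'a set \<Rightarrow> 'a parametrization set \<Rightarrow> 'a \<Rightarrow> (real, ('a set \<times> ('a \<Rightarrow> real)) set \<Rightarrow> real) module"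
  where "right_tangent_space X P x = derivation_space (germ_algebra X P x) (germ_value x)"

definition global_right_tangent_space ::
    "'a set \<Rightarrow> 'a parametrization set \<Rightarrow> 'a \<Rightarrow> (real, ('a \<Rightarrow> real) \<Rightarrow> real) module"
  where "global_right_tangent_space X P x = derivation_space (smooth_algebra X P) (\<lambda>g. g x)"

definition module_iso ::
    "('r, 'k) ring_scheme \<Rightarrow> ('r, 'v, 'm) module_scheme \<Rightarrow> ('r, 'w, 'n) module_scheme \<Rightarrow> ('v \<Rightarrow> 'w) set"
  where "module_iso R V W =
    {\<phi> \<in> iso (add_monoid V) (add_monoid W).
       \<forall>c\<in>carrier R. \<forall>v\<in>carrier V. \<phi> (c \<odot>\<^bsub>V\<^esub> v) = c \<odot>\<^bsub>W\<^esub> \<phi> v}"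

end

theory Submission
  imports Defs
begin

text \<open>Taking germs is an algebra homomorphism \<open>r\<close> from the smooth functions to the germs at \<open>x\<close> that
  preserves values at \<open>x\<close>. Smooth regularity yields cut-off functions that equal 1 near \<open>x\<close> and
  whose support lies in a given neighbourhood, so every germ is represented by a global function
  and \<open>r\<close> is surjective. A global derivation is local: if \<open>f\<close> and \<open>g\<close> have the same germ then
  \<open>l * f = l * g\<close> for some \<open>l\<close> with \<open>l x = 1\<close>, and the Leibniz rule gives \<open>D f = D g\<close>. Hence global
  derivations factor uniquely through \<open>r\<close>.\<close>

section \<open>Smooth functions on Euclidean open sets\<close>

lemma continuous_map_fun_upd_Euclidean_space:
  assumes "x \<in> topspace (Euclidean_space n)" "i < n"
  shows "continuous_map euclideanreal (Euclidean_space n) (\<lambda>t. x(i := t))"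
proof -
  have "continuous_map euclideanreal euclideanreal (\<lambda>t. (x(i := t)) j)" for j
    by (cases "j = i") auto
  then show ?thesis
    using assms
    by (auto simp: Euclidean_space_def continuous_map_in_subtopology continuous_map_componentwise_UNIV)
qed

text \<open>Moving one coordinate \<open>i < n\<close> is a continuous map from the line into
  \<open>Euclidean_space n\<close>, so the preimage of \<open>U\<close> is open. Partial derivatives
  at points of \<open>U\<close> therefore see only values of a function on \<open>U\<close>.\<close>

lemma eventually_fun_upd_mem:
  assumes "openin (Euclidean_space n) U" "x \<in> U" "i < n"
  shows "\<forall>\<^sub>F t in nhds (x i). x(i := t) \<in> U"
proof -
  have "x \<in> topspace (Euclidean_space n)"
    using assms openin_subset by blast
  then have "openin euclideanreal {t \<in> topspace euclideanreal. x(i := t) \<in> U}"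
    using assms(1,3)
    by (intro openin_continuous_map_preimage[OF continuous_map_fun_upd_Euclidean_space])
  then show ?thesis
    using assms(2) by (auto simp: eventually_nhds)
qed

lemma C_k_on_imp_continuous_map:
  "C_k_on n k U f \<Longrightarrow> continuous_map (subtopology (Euclidean_space n) U) euclideanreal f"
  by (cases k) auto

text \<open>Functions are total here, but a partial derivative at a point of the open set
  \<open>U\<close> depends only on nearby values along a coordinate line, and these are taken inside
  \<open>U\<close>. Agreement on \<open>U\<close> thus passes to the partial derivatives and the
  induction goes through.\<close>

lemma C_k_on_cong:
  assumes "openin (Euclidean_space n) U" "\<And>x. x \<in> U \<Longrightarrow> f x = g x" "C_k_on n k U f"
  shows "C_k_on n k U g"
  using assms(2,3)
proof (induction k arbitrary: f g)
  case 0
  then show ?case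
    by (auto elim!: continuous_map_eq)
next
  case (Suc k)
  have ev: "\<forall>\<^sub>F t in nhds (x i). f (x(i := t)) = g (x(i := t))" if "i < n" "x \<in> U" for i x
    using eventually_fun_upd_mem[OF assms(1) that(2,1)] by eventually_elim (rule Suc.prems(1))
  have "partial_deriv i f x = partial_deriv i g x" if "i < n" "x \<in> U" for i x
    unfolding partial_deriv_def using ev[OF that] by (rule deriv_cong_ev) simp
  then have "C_k_on n k U (partial_deriv i g)" if "i < n" for i
    using that Suc.prems(2) by (intro Suc.IH[of "partial_deriv i f" "partial_deriv i g"]) auto
  moreover have "(\<lambda>t. g (x(i := t))) differentiable (at (x i))" if "i < n" "x \<in> U" for i x
  proof -
    have "DERIV (\<lambda>t. f (x(i := t))) (x i) :> partial_deriv i f x"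
      unfolding partial_deriv_def
      using Suc.prems(2) that by (simp add: DERIV_deriv_iff_real_differentiable)
    then have "DERIV (\<lambda>t. g (x(i := t))) (x i) :> partial_deriv i f x"
      using DERIV_cong_ev[OF refl ev[OF that] refl] by simp
    then show ?thesis
      using real_differentiable_def by blast
  qed
  moreover have "continuous_map (subtopology (Euclidean_space n) U) euclideanreal g"
    using Suc.prems by (auto elim!: continuous_map_eq)
  ultimately show ?case by simp
qed

lemma C_k_on_DERIV:
  assumes "C_k_on n (Suc k) U f" "i < n" "x \<in> U"
  shows "DERIV (\<lambda>t. f (x(i := t))) (x i) :> partial_deriv i f x"
  unfolding partial_deriv_def
  using assms by (simp add: DERIV_deriv_iff_real_differentiable)

text \<open>By \<open>C_k_on_cong\<close> any formula \<open>f'\<close> that computes the partial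
  derivatives on \<open>U\<close> may replace \<open>partial_deriv\<close>. The closure properties
  below then reduce to the usual rules of differentiation.\<close>

lemma C_k_on_SucI:
  assumes U: "openin (Euclidean_space n) U"
    and "continuous_map (subtopology (Euclidean_space n) U) euclideanreal f"
    and D: "\<And>i x. i < n \<Longrightarrow> x \<in> U \<Longrightarrow> DERIV (\<lambda>t. f (x(i := t))) (x i) :> f' i x"
    and f': "\<And>i. i < n \<Longrightarrow> C_k_on n k U (f' i)"
  shows "C_k_on n (Suc k) U f"
proof -
  have "C_k_on n k U (partial_deriv i f)" if "i < n" for i
  proof (rule C_k_on_cong[OF U _ f'[OF that]])
    show "f' i x = partial_deriv i f x" if "x \<in> U" for x
      using D[OF \<open>i < n\<close> that] unfolding partial_deriv_def by (simp add: DERIV_imp_deriv)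
  qed
  moreover have "(\<lambda>t. f (x(i := t))) differentiable (at (x i))" if "i < n" "x \<in> U" for i x
    using D[OF that] real_differentiable_def by blast
  ultimately show ?thesis using assms(2) by simp
qed

lemma C_k_on_SucD: "C_k_on n (Suc k) U f \<Longrightarrow> C_k_on n k U f"
  by (induction k arbitrary: f) auto

lemma C_k_on_subset: "C_k_on n k U f \<Longrightarrow> V \<subseteq> U \<Longrightarrow> C_k_on n k V f"
proof (induction k arbitrary: f)
  case 0
  then show ?case by (auto intro: continuous_map_from_subtopology_mono)
next
  case (Suc k)
  have "continuous_map (subtopology (Euclidean_space n) V) euclideanreal f"
    using Suc.prems by (auto intro: continuous_map_from_subtopology_mono)
  then show ?case using Suc by auto
qed

text \<open>For an open domain, openness of preimages can be tested in \<open>T\<close> itself,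
  where the preimage over \<open>U \<union> V\<close> is the union of the two given ones.\<close>

lemma continuous_map_subtopology_Un_openin:
  assumes U: "openin T U" and V: "openin T V"
    and f: "continuous_map (subtopology T U) T' f" "continuous_map (subtopology T V) T' f"
  shows "continuous_map (subtopology T (U \<union> V)) T' f"
proof -
  have *: "continuous_map (subtopology T W) T' f \<longleftrightarrow>
      f \<in> W \<rightarrow> topspace T' \<and> (\<forall>A. openin T' A \<longrightarrow> openin T {u \<in> W. f u \<in> A})"
    if "openin T W" for W
  proof -
    have "topspace (subtopology T W) = W"
      using openin_subset[OF that] by auto
    then show ?thesis
      by (auto simp: continuous_map_def openin_open_subtopology[OF that])
  qed
  have "openin T {u \<in> U \<union> V. f u \<in> A}" if "openin T' A" for A
  proof -
    have "openin T ({u \<in> U. f u \<in> A} \<union> {u \<in> V. f u \<in> A})"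
      using f that *[OF U] *[OF V] by (intro openin_Un) auto
    moreover have "{u \<in> U. f u \<in> A} \<union> {u \<in> V. f u \<in> A} = {u \<in> U \<union> V. f u \<in> A}"
      by blast
    ultimately show ?thesis by simp
  qed
  then show ?thesis
    using f *[OF U] *[OF V] *[OF openin_Un[OF U V]] by blast
qed

lemma C_k_on_Un:
  assumes U: "openin (Euclidean_space n) U" and V: "openin (Euclidean_space n) V"
  shows "C_k_on n k U f \<Longrightarrow> C_k_on n k V f \<Longrightarrow> C_k_on n k (U \<union> V) f"
proof (induction k arbitrary: f)
  case 0
  then show ?case
    using U V by (auto intro: continuous_map_subtopology_Un_openin)
next
  case (Suc k)
  then have "continuous_map (subtopology (Euclidean_space n) (U \<union> V)) euclideanreal f"
    using U V by (auto intro: continuous_map_subtopology_Un_openin)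
  then show ?case using Suc by auto
qed

section \<open>Closure of the C^k functions under constants, sums, products and coordinates\<close>

lemma C_k_on_const:
  assumes "openin (Euclidean_space n) U"
  shows "C_k_on n k U (\<lambda>x. c)"
proof (induction k arbitrary: c)
  case (Suc k)
  show ?case
    by (rule C_k_on_SucI[OF assms, where f' = "\<lambda>i x. 0"]) (auto simp: Suc)
qed simp

lemma C_k_on_add:
  assumes U: "openin (Euclidean_space n) U"
  shows "C_k_on n k U f \<Longrightarrow> C_k_on n k U g \<Longrightarrow> C_k_on n k U (\<lambda>x. f x + g x)"
proof (induction k arbitrary: f g)
  case 0
  then show ?case by (auto intro: continuous_intros)
next
  case (Suc k)
  show ?case
  proof (rule C_k_on_SucI[OF U])
    show "continuous_map (subtopology (Euclidean_space n) U) euclideanreal (\<lambda>x. f x + g x)"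
      using Suc.prems by (auto intro: continuous_intros)
    show "DERIV (\<lambda>t. f (x(i := t)) + g (x(i := t))) (x i) :> partial_deriv i f x + partial_deriv i g x"
      if "i < n" "x \<in> U" for i x
      by (rule DERIV_add[OF C_k_on_DERIV[OF Suc.prems(1) that] C_k_on_DERIV[OF Suc.prems(2) that]])
    show "C_k_on n k U (\<lambda>x. partial_deriv i f x + partial_deriv i g x)" if "i < n" for i
      using Suc.prems that by (intro Suc.IH) auto
  qed
qed

lemma C_k_on_mult:
  assumes U: "openin (Euclidean_space n) U"
  shows "C_k_on n k U f \<Longrightarrow> C_k_on n k U g \<Longrightarrow> C_k_on n k U (\<lambda>x. f x * g x)"
proof (induction k arbitrary: f g)
  case 0
  then show ?case by (auto intro: continuous_intros)
next
  case (Suc k)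
  show ?case
  proof (rule C_k_on_SucI[OF U])
    show "continuous_map (subtopology (Euclidean_space n) U) euclideanreal (\<lambda>x. f x * g x)"
      using Suc.prems by (auto intro: continuous_intros)
    show "DERIV (\<lambda>t. f (x(i := t)) * g (x(i := t))) (x i) :>
        partial_deriv i f x * g x + partial_deriv i g x * f x"
      if "i < n" "x \<in> U" for i x
      using DERIV_mult[OF C_k_on_DERIV[OF Suc.prems(1) that] C_k_on_DERIV[OF Suc.prems(2) that]]
      by (simp only: fun_upd_triv)
    \<comment> \<open>The Leibniz formula contains \<open>f\<close> and \<open>g\<close>
      undifferentiated, so these are weakened from order \<open>Suc k\<close> to \<open>k\<close>
      before the induction hypothesis applies.\<close>
    show "C_k_on n k U (\<lambda>x. partial_deriv i f x * g x + partial_deriv i g x * f x)" if "i < n" for i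
      using Suc.prems C_k_on_SucD[OF Suc.prems(1)] C_k_on_SucD[OF Suc.prems(2)] that
      by (intro C_k_on_add[OF U] Suc.IH) auto
  qed
qed

lemma C_k_on_coordinate:
  assumes U: "openin (Euclidean_space n) U"
  shows "C_k_on n k U (\<lambda>x. x j)"
proof -
  have cont: "continuous_map (subtopology (Euclidean_space n) U) euclideanreal (\<lambda>x. x j)"
    unfolding Euclidean_space_def subtopology_subtopology
    by (intro continuous_map_from_subtopology continuous_map_product_projection) simp
  show ?thesis
  proof (cases k)
    case (Suc k)
    have "C_k_on n (Suc k) U (\<lambda>x. x j)"
    proof (rule C_k_on_SucI[OF U cont])
      show "DERIV (\<lambda>t. (x(i := t)) j) (x i) :> (if i = j then 1 else 0)" for i x
        by auto
    qed (rule C_k_on_const[OF U])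
    then show ?thesis using Suc by simp
  qed (use cont in simp)
qed

section \<open>A flat function\<close>

text \<open>The factor \<open>inverse t ^ k\<close> makes the family closed under differentiation, up to linear
  combinations.\<close>

definition flat_exp :: "nat \<Rightarrow> real \<Rightarrow> real"
  where "flat_exp k t = (if t > 0 then inverse t ^ k * exp (- inverse t) else 0)"

lemma flat_exp_nonpos: "t \<le> 0 \<Longrightarrow> flat_exp k t = 0"
  by (simp add: flat_exp_def)

lemma flat_exp_0_pos: "t > 0 \<Longrightarrow> flat_exp 0 t > 0"
  by (simp add: flat_exp_def)

lemma flat_exp_0_mono: "s \<le> t \<Longrightarrow> flat_exp 0 s \<le> flat_exp 0 t"
  by (auto simp: flat_exp_def field_simps)

text \<open>This quotient is the difference quotient of \<open>flat_exp k\<close> at 0. On the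
  right, with u = 1/t, it equals u^(k+1) / exp u, which tends to 0 as u grows.\<close>

lemma flat_exp_over_tendsto_0: "((\<lambda>t. flat_exp k t / t) \<longlongrightarrow> 0) (at 0)"
proof (rule filterlim_split_at)
  have "((\<lambda>t::real. 0) \<longlongrightarrow> 0) (at_left 0)" by simp
  then show "((\<lambda>t. flat_exp k t / t) \<longlongrightarrow> 0) (at_left 0)"
    by (rule Lim_transform_eventually)
      (auto simp: eventually_at_filter flat_exp_def)
  have "((\<lambda>t::real. inverse t ^ Suc k / exp (inverse t)) \<longlongrightarrow> 0) (at_right 0)"
    using filterlim_compose[OF tendsto_power_div_exp_0 filterlim_inverse_at_top_right] .
  then show "((\<lambda>t. flat_exp k t / t) \<longlongrightarrow> 0) (at_right 0)"
    by (rule Lim_transform_eventually)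
      (auto simp: eventually_at_filter flat_exp_def exp_minus field_simps)
qed

lemma DERIV_flat_exp:
  "DERIV (flat_exp k) t :> flat_exp (k + 2) t + (- real k) * flat_exp (k + 1) t"
proof -
  consider "t > 0" | "t < 0" | "t = 0" by linarith
  then show ?thesis
  proof cases
    case 1
    let ?u = "inverse t"
    have "DERIV (\<lambda>s. inverse s ^ k * exp (- inverse s)) t :>
        real k * (- (?u * ?u) * ?u ^ (k - 1)) * exp (- ?u) + ?u ^ k * (exp (- ?u) * (?u * ?u))"
      using 1 by (auto intro!: derivative_eq_intros)
    also have "real k * (- (?u * ?u) * ?u ^ (k - 1)) * exp (- ?u) + ?u ^ k * (exp (- ?u) * (?u * ?u)) =
        flat_exp (k + 2) t + (- real k) * flat_exp (k + 1) t"
      \<comment> \<open>The case split deals with the truncated exponent \<open>k - 1\<close>: for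
        \<open>k = 0\<close> the factor \<open>real k\<close> kills the term, otherwise the powers
        combine to exponent \<open>k + 1\<close>.\<close>
      using 1 by (cases k) (simp_all add: flat_exp_def algebra_simps)
    finally have "DERIV (\<lambda>s. inverse s ^ k * exp (- inverse s)) t :>
        flat_exp (k + 2) t + (- real k) * flat_exp (k + 1) t" .
    then show ?thesis
      by (rule has_field_derivative_transform_within_open[of _ _ _ "{0<..}"])
        (use 1 in \<open>auto simp: flat_exp_def\<close>)
  next
    case 2
    have "DERIV (\<lambda>s. 0) t :> flat_exp (k + 2) t + (- real k) * flat_exp (k + 1) t"
      using 2 by (simp add: flat_exp_nonpos)
    then show ?thesis
      by (rule has_field_derivative_transform_within_open[of _ _ _ "{..<0}"])
        (use 2 in \<open>auto simp: flat_exp_nonpos\<close>)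
  next
    case 3
    then show ?thesis
      using flat_exp_over_tendsto_0[of k] by (simp add: DERIV_def flat_exp_nonpos)
  qed
qed

lemma continuous_map_flat_exp:
  assumes "continuous_map T euclideanreal f"
  shows "continuous_map T euclideanreal (\<lambda>x. flat_exp j (f x))"
proof -
  have "continuous_map euclideanreal euclideanreal (flat_exp j)"
    using DERIV_isCont[OF DERIV_flat_exp] by (simp add: continuous_at_imp_continuous_on)
  from continuous_map_compose[OF assms this] show ?thesis by (simp add: o_def)
qed

text \<open>Differentiation turns index \<open>j\<close> into \<open>j + 1\<close> and
  \<open>j + 2\<close>, so the induction varies \<open>j\<close> while \<open>f\<close> stays fixed.
  The inner derivative of \<open>f\<close> is C^k by assumption.\<close>

lemma C_k_on_flat_exp:
  assumes U: "openin (Euclidean_space n) U"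
  shows "C_k_on n k U f \<Longrightarrow> C_k_on n k U (\<lambda>x. flat_exp j (f x))"
proof (induction k arbitrary: j)
  case 0
  then show ?case by (simp add: continuous_map_flat_exp)
next
  case (Suc k)
  show ?case
  proof (rule C_k_on_SucI[OF U])
    show "continuous_map (subtopology (Euclidean_space n) U) euclideanreal (\<lambda>x. flat_exp j (f x))"
      using Suc.prems by (simp add: continuous_map_flat_exp)
    show "DERIV (\<lambda>t. flat_exp j (f (x(i := t)))) (x i) :>
        (flat_exp (j + 2) (f x) + (- real j) * flat_exp (j + 1) (f x)) * partial_deriv i f x"
      if "i < n" "x \<in> U" for i x
      using DERIV_chain2[OF DERIV_flat_exp C_k_on_DERIV[OF Suc.prems that], of j]
      by (simp only: fun_upd_triv)
    show "C_k_on n k U (\<lambda>x. (flat_exp (j + 2) (f x) + (- real j) * flat_exp (j + 1) (f x)) *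
        partial_deriv i f x)" if "i < n" for i
      using Suc.prems that
      by (intro C_k_on_mult[OF U] C_k_on_add[OF U] C_k_on_const[OF U] Suc.IH
          C_k_on_SucD[OF Suc.prems]) auto
  qed
qed

section \<open>Smooth functions on diffeological spaces\<close>

text \<open>Replacing the extensional composite by the plain one changes no value on
  \<open>U\<close>, so by \<open>C_k_on_cong\<close> smoothness can be handled with total
  functions.\<close>

lemma smooth_functions_iff:
  assumes "Q \<subseteq> parametrizations Y"
  shows "f \<in> smooth_functions Y Q \<longleftrightarrow>
    f \<in> Y \<rightarrow>\<^sub>E UNIV \<and> (\<forall>n U p k. (n, U, p) \<in> Q \<longrightarrow> C_k_on n k U (\<lambda>u. f (p u)))"
proof -
  have "(n, U, compose U f p) \<in> real_plots \<longleftrightarrow> (\<forall>k. C_k_on n k U (\<lambda>u. f (p u)))"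
    if "(n, U, p) \<in> Q" for n U p
  proof -
    have U: "openin (Euclidean_space n) U"
      using that assms by (auto simp: parametrizations_def)
    have "C_k_on n k U (compose U f p) \<longleftrightarrow> C_k_on n k U (\<lambda>u. f (p u))" for k
      using C_k_on_cong[OF U, of "compose U f p" "\<lambda>u. f (p u)" k]
        C_k_on_cong[OF U, of "\<lambda>u. f (p u)" "compose U f p" k]
      by (auto simp: compose_def)
    then show ?thesis
      using U by (auto simp: real_plots_def parametrizations_def C_infinity_on_def compose_def)
  qed
  then show ?thesis
    unfolding smooth_maps_def by fast
qed

lemma smooth_functionsI:
  assumes "Q \<subseteq> parametrizations Y"
    and "\<And>n U p k. (n, U, p) \<in> Q \<Longrightarrow> openin (Euclidean_space n) U \<Longrightarrow> p \<in> U \<rightarrow> Y \<Longrightarrow>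
      C_k_on n k U (\<lambda>u. f (p u))"
  shows "restrict f Y \<in> smooth_functions Y Q"
proof -
  have "C_k_on n k U (\<lambda>u. restrict f Y (p u))" if "(n, U, p) \<in> Q" for n U p k
  proof -
    have U: "openin (Euclidean_space n) U" and p: "p \<in> U \<rightarrow> Y"
      using that assms(1) by (auto simp: parametrizations_def)
    show ?thesis
      by (rule C_k_on_cong[OF U _ assms(2)[OF that U p]]) (use p in auto)
  qed
  then show ?thesis
    using assms(1) by (auto simp: smooth_functions_iff)
qed

lemma smooth_functionsD:
  "Q \<subseteq> parametrizations Y \<Longrightarrow> f \<in> smooth_functions Y Q \<Longrightarrow> (n, U, p) \<in> Q \<Longrightarrow>
    C_k_on n k U (\<lambda>u. f (p u))"
  by (simp add: smooth_functions_iff)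

lemma smooth_functions_add:
  "Q \<subseteq> parametrizations Y \<Longrightarrow> f \<in> smooth_functions Y Q \<Longrightarrow> g \<in> smooth_functions Y Q \<Longrightarrow>
    (\<lambda>y\<in>Y. f y + g y) \<in> smooth_functions Y Q"
  by (rule smooth_functionsI) (auto simp: smooth_functions_iff intro!: C_k_on_add)

lemma smooth_functions_mult:
  "Q \<subseteq> parametrizations Y \<Longrightarrow> f \<in> smooth_functions Y Q \<Longrightarrow> g \<in> smooth_functions Y Q \<Longrightarrow>
    (\<lambda>y\<in>Y. f y * g y) \<in> smooth_functions Y Q"
  by (rule smooth_functionsI) (auto simp: smooth_functions_iff intro!: C_k_on_mult)

lemma smooth_functions_cmult:
  "Q \<subseteq> parametrizations Y \<Longrightarrow> f \<in> smooth_functions Y Q \<Longrightarrow>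
    (\<lambda>y\<in>Y. c * f y) \<in> smooth_functions Y Q"
  by (rule smooth_functionsI) (auto simp: smooth_functions_iff intro!: C_k_on_mult C_k_on_const)

lemma smooth_functions_flat_exp:
  "Q \<subseteq> parametrizations Y \<Longrightarrow> f \<in> smooth_functions Y Q \<Longrightarrow>
    (\<lambda>y\<in>Y. flat_exp j (a + b * f y)) \<in> smooth_functions Y Q"
  by (rule smooth_functionsI)
    (auto simp: smooth_functions_iff intro!: C_k_on_flat_exp C_k_on_add C_k_on_mult C_k_on_const)

lemma smooth_functions_restrict:
  assumes "Q \<subseteq> parametrizations Y" "Q' \<subseteq> Q" "Q' \<subseteq> parametrizations B" "f \<in> smooth_functions Y Q"
  shows "restrict f B \<in> smooth_functions B Q'"
  by (rule smooth_functionsI) (use assms in \<open>auto simp: smooth_functions_iff\<close>)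

text \<open>Being D-open is tested along plots, and the composite of \<open>f\<close> with a plot is
  continuous.\<close>

lemma openin_D_topology_preimage_smooth:
  assumes P: "P \<subseteq> parametrizations X" and f: "f \<in> smooth_functions X P" and "open S"
  shows "openin (D_topology X P) {y \<in> X. f y \<in> S}"
proof -
  have "openin (Euclidean_space n) {u \<in> U. p u \<in> {y \<in> X. f y \<in> S}}" if "(n, U, p) \<in> P" for n U p
  proof -
    have U: "openin (Euclidean_space n) U" and p: "p \<in> U \<rightarrow> X"
      using that P by (auto simp: parametrizations_def)
    have top: "topspace (subtopology (Euclidean_space n) U) = U"
      using openin_subset[OF U] by auto
    have "continuous_map (subtopology (Euclidean_space n) U) euclideanreal (\<lambda>u. f (p u))"
      using smooth_functionsD[OF P f that] C_k_on_imp_continuous_map by blast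
    then have "openin (subtopology (Euclidean_space n) U) {u \<in> U. f (p u) \<in> S}"
      using openin_continuous_map_preimage[of _ euclideanreal _ S] \<open>open S\<close> top by fastforce
    then have "openin (Euclidean_space n) {u \<in> U. f (p u) \<in> S}"
      using openin_open_subtopology[OF U] by blast
    moreover have "{u \<in> U. p u \<in> {y \<in> X. f y \<in> S}} = {u \<in> U. f (p u) \<in> S}"
      using p by auto
    ultimately show ?thesis by simp
  qed
  then show ?thesis
    by (auto simp: openin_D_topology[OF P])
qed

lemma smoothly_regularE:
  assumes "smoothly_regular_at X P x" "openin (D_topology X P) U" "x \<in> U"
  obtains l where "l \<in> smooth_functions X P" "l x = 1" "\<forall>y\<in>X - U. l y = 0"
proof -
  have "\<exists>l\<in>smooth_functions X P. l x = 1 \<and> (\<forall>y\<in>X - U. l y = 0)"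
    using assms(1)[unfolded smoothly_regular_at_def, THEN spec, of U] assms(2,3)
    by (simp only: simp_thms)
  then show ?thesis
    using that by (elim bexE conjE)
qed

section \<open>Extension by zero and cut-off functions\<close>

context diffeological_space
begin

text \<open>Restriction is composition with the inclusion of \<open>V\<close> into \<open>U\<close>,
  which is smooth because its components are coordinate functions.\<close>

lemma plot_restrict:
  assumes "(n, U, p) \<in> P" "openin (Euclidean_space n) V" "V \<subseteq> U"
  shows "(n, V, restrict p V) \<in> P"
proof -
  have "C_infinity_map n V n U (\<lambda>v. v)"
    using assms by (auto simp: C_infinity_map_def C_infinity_on_def intro: C_k_on_coordinate)
  from plot_compose[OF assms(1,2) this] show ?thesis
    by (simp add: compose_def restrict_def)
qed

text \<open>Along a plot, the preimages of \<open>B\<close> and \<open>C\<close> form an open cover.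
  On the first the function is a product of smooth functions, on the second it is zero, and
  smoothness glues by \<open>C_k_on_Un\<close>.\<close>

lemma smooth_extension_by_zero:
  assumes B: "openin (D_topology X P) B" and g: "g \<in> smooth_functions B (subdiffeology P B)"
    and m: "m \<in> smooth_functions X P"
    and C: "openin (D_topology X P) C" and cover: "B \<union> C = X" and m0: "\<And>y. y \<in> C \<Longrightarrow> m y = 0"
  shows "(\<lambda>y\<in>X. if y \<in> B then m y * g y else 0) \<in> smooth_functions X P"
proof (rule smooth_functionsI[OF plots_subset])
  fix n U p k
  assume p: "(n, U, p) \<in> P" and U: "openin (Euclidean_space n) U" and pX: "p \<in> U \<rightarrow> X"
  let ?h = "\<lambda>u. if p u \<in> B then m (p u) * g (p u) else 0"
  let ?V = "{u \<in> U. p u \<in> B}" and ?W = "{u \<in> U. p u \<in> C}"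
  have V: "openin (Euclidean_space n) ?V" and W: "openin (Euclidean_space n) ?W"
    using B C p by (auto simp: openin_D_topology[OF plots_subset])
  \<comment> \<open>Since \<open>g\<close> can be tested only on plots of \<open>B\<close>, the plot
    \<open>p\<close> is first cut down to \<open>?V\<close>.\<close>
  have "(n, ?V, restrict p ?V) \<in> P"
    by (rule plot_restrict[OF p V]) auto
  then have "(n, ?V, restrict p ?V) \<in> subdiffeology P B"
    using V by (auto simp: subdiffeology_def parametrizations_def)
  then have "C_k_on n k ?V (\<lambda>u. g (restrict p ?V u))"
    by (rule smooth_functionsD[OF _ g, rotated]) (auto simp: subdiffeology_def)
  then have "C_k_on n k ?V (\<lambda>u. m (p u) * g (restrict p ?V u))"
    by (intro C_k_on_mult[OF V] C_k_on_subset[OF smooth_functionsD[OF plots_subset m p]]) auto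
  then have "C_k_on n k ?V ?h"
    by (rule C_k_on_cong[OF V, rotated]) auto
  \<comment> \<open>Points of \<open>?W\<close> may also lie over \<open>B\<close>; there
    \<open>m\<close> vanishes, so both branches give 0.\<close>
  moreover have "C_k_on n k ?W ?h"
    by (rule C_k_on_cong[OF W _ C_k_on_const[OF W, of _ 0]]) (simp add: m0)
  moreover have "?V \<union> ?W = U"
    using cover pX by auto
  ultimately show "C_k_on n k U ?h"
    using C_k_on_Un[OF V W, of k ?h] by (simp only:)
qed

text \<open>Regularity controls \<open>l\<close> only at \<open>x\<close> and outside
  \<open>B\<close>. Preserving a germ requires the value 1 on a whole neighbourhood
  \<open>W\<close>, and extension by zero requires vanishing on an open set \<open>C\<close> that
  contains the complement of \<open>B\<close>.\<close>

lemma smooth_cutoff: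
  assumes reg: "smoothly_regular_at X P x" and B: "openin (D_topology X P) B" "x \<in> B"
  obtains m C W where "m \<in> smooth_functions X P"
    and "openin (D_topology X P) C" "B \<union> C = X" "\<And>y. y \<in> C \<Longrightarrow> m y = 0"
    and "openin (D_topology X P) W" "x \<in> W" "W \<subseteq> B" "\<And>y. y \<in> W \<Longrightarrow> m y = 1"
proof -
  obtain l where l: "l \<in> smooth_functions X P" "l x = 1" "\<forall>y\<in>X - B. l y = 0"
    by (rule smoothly_regularE[OF reg B])
  have BX: "B \<subseteq> X"
    using openin_subset[OF B(1)] topspace_D_topology[OF plots_subset] by simp
  txt \<open>Applying \<open>flat_exp\<close> twice gives a plateau without a quotient of smooth functions: \<open>b\<close> is
    at least \<open>?c\<close> where \<open>l \<le> 1/2\<close> and vanishes where \<open>l \<ge> 3/4\<close>.\<close>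
  let ?c = "flat_exp 0 (1/4)"
  define b where "b = (\<lambda>y\<in>X. flat_exp 0 (3/4 + (-1) * l y))"
  define e where "e = (\<lambda>y\<in>X. flat_exp 0 (?c + (-1) * b y))"
  \<comment> \<open>The constant factor is the reciprocal of the value of \<open>e\<close> where
    \<open>b\<close> vanishes, which makes the plateau have height 1.\<close>
  define m where "m = (\<lambda>y\<in>X. inverse (flat_exp 0 ?c) * e y)"
  have "b \<in> smooth_functions X P"
    unfolding b_def by (rule smooth_functions_flat_exp[OF plots_subset l(1)])
  then have "e \<in> smooth_functions X P"
    unfolding e_def by (rule smooth_functions_flat_exp[OF plots_subset])
  then have "m \<in> smooth_functions X P"
    unfolding m_def by (rule smooth_functions_cmult[OF plots_subset])
  moreover have "openin (D_topology X P) {y \<in> X. l y \<in> {..<1/2}}"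
    "openin (D_topology X P) {y \<in> X. l y \<in> {3/4<..}}"
    by (rule openin_D_topology_preimage_smooth[OF plots_subset l(1)], simp)+
  moreover have "B \<union> {y \<in> X. l y \<in> {..<1/2}} = X"
    using l(3) BX by force
  moreover have "m y = 0" if "y \<in> {y \<in> X. l y \<in> {..<1/2}}" for y
  proof -
    have "?c \<le> b y"
      using that flat_exp_0_mono[of "1/4" "3/4 + (-1) * l y"] by (simp add: b_def)
    then show ?thesis
      using that by (simp add: m_def e_def flat_exp_nonpos)
  qed
  moreover have "{y \<in> X. l y \<in> {3/4<..}} \<subseteq> B"
    using l(3) by force
  moreover have "m y = 1" if "y \<in> {y \<in> X. l y \<in> {3/4<..}}" for y
  proof -
    have "b y = 0"
      using that by (simp add: b_def flat_exp_nonpos)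
    moreover have "flat_exp 0 ?c > 0"
      by (intro flat_exp_0_pos) simp
    ultimately show ?thesis
      using that by (simp add: m_def e_def)
  qed
  moreover have "x \<in> {y \<in> X. l y \<in> {3/4<..}}"
    using l(2) B(2) BX by auto
  ultimately show ?thesis
    using that[of m "{y \<in> X. l y \<in> {..<1/2}}" "{y \<in> X. l y \<in> {3/4<..}}"] by blast
qed

end

section \<open>Germs\<close>

lemma equiv_germ_rel: "equiv (local_functions X P x) (germ_rel X P x)"
proof (rule equivI)
  show "germ_rel X P x \<subseteq> local_functions X P x \<times> local_functions X P x"
    by (auto simp: germ_rel_def)
  show "refl_on (local_functions X P x) (germ_rel X P x)"
    by (rule refl_onI) (auto simp: germ_rel_def local_functions_def)
  show "sym (germ_rel X P x)"
  proof (rule symI)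
    fix a b assume ab: "(a, b) \<in> germ_rel X P x"
    obtain B g B' h where eq: "a = (B, g)" "b = (B', h)"
      by (metis surj_pair)
    obtain W where "openin (D_topology X P) W" "x \<in> W" "W \<subseteq> B \<inter> B'" "\<forall>y\<in>W. g y = h y"
      using ab by (auto simp: germ_rel_def eq)
    then have "openin (D_topology X P) W" "x \<in> W" "W \<subseteq> B' \<inter> B" "\<forall>y\<in>W. h y = g y"
      by auto
    then show "(b, a) \<in> germ_rel X P x"
      using ab unfolding germ_rel_def eq by blast
  qed
  show "trans (germ_rel X P x)"
  proof (rule transI)
    fix a b c
    assume ab: "(a, b) \<in> germ_rel X P x" and bc: "(b, c) \<in> germ_rel X P x"
    obtain B1 g1 B2 g2 B3 g3 where eq: "a = (B1, g1)" "b = (B2, g2)" "c = (B3, g3)"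
      by (metis surj_pair)
    obtain V where V: "openin (D_topology X P) V" "x \<in> V" "V \<subseteq> B1 \<inter> B2" "\<forall>y\<in>V. g1 y = g2 y"
      using ab by (auto simp: germ_rel_def eq)
    obtain W where W: "openin (D_topology X P) W" "x \<in> W" "W \<subseteq> B2 \<inter> B3" "\<forall>y\<in>W. g2 y = g3 y"
      using bc by (auto simp: germ_rel_def eq)
    have "openin (D_topology X P) (V \<inter> W)" "x \<in> V \<inter> W" "V \<inter> W \<subseteq> B1 \<inter> B3" "\<forall>y\<in>V \<inter> W. g1 y = g3 y"
      using V W by auto
    then show "(a, c) \<in> germ_rel X P x"
      using ab bc unfolding germ_rel_def eq by blast
  qed
qed

lemma germ_eq_iff:
  assumes "(B, g) \<in> local_functions X P x" "(B', h) \<in> local_functions X P x"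
  shows "germ X P x B g = germ X P x B' h \<longleftrightarrow> ((B, g), (B', h)) \<in> germ_rel X P x"
  unfolding germ_def using eq_equiv_class_iff[OF equiv_germ_rel assms] .

lemma mem_germ_iff: "(B', h) \<in> germ X P x B g \<longleftrightarrow> ((B, g), (B', h)) \<in> germ_rel X P x"
  by (simp add: germ_def)

lemma germ_relD:
  assumes "((B, g), (B', h)) \<in> germ_rel X P x"
  shows "(B, g) \<in> local_functions X P x" "(B', h) \<in> local_functions X P x" "g x = h x"
  using assms by (auto simp: germ_rel_def)

lemma germ_self_mem: "(B, g) \<in> local_functions X P x \<Longrightarrow> (B, g) \<in> germ X P x B g"
  unfolding germ_def using equiv_class_self[OF equiv_germ_rel] .

text \<open>All representatives agree on a neighbourhood that contains \<open>x\<close>, so the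
  image under evaluation is a singleton and \<open>the_elem\<close> picks out its element.\<close>

lemma germ_value_germ:
  assumes "(B, g) \<in> local_functions X P x"
  shows "germ_value x (germ X P x B g) = g x"
proof -
  have "(\<lambda>(B, g). g x) ` germ X P x B g = {g x}"
    using germ_self_mem[OF assms] by (force simp: mem_germ_iff dest: germ_relD)
  then show ?thesis by (simp add: germ_value_def)
qed

section \<open>Operations on germs computed on representatives\<close>

text \<open>Plots of \<open>B \<inter> B'\<close> are plots of both \<open>B\<close> and
  \<open>B'\<close>, so both restrictions are smooth there. The closure of smooth functions under
  \<open>op\<close> is assumed for every \<open>Y\<close> and \<open>Q\<close>, which allows its use
  on the intersection and covers sum and product at once.\<close>

lemma local_functions_binop:
  fixes X :: "'a set"
  assumes op: "\<And>Q (Y :: 'a set) f g. Q \<subseteq> parametrizations Y \<Longrightarrow> f \<in> smooth_functions Y Q \<Longrightarrow>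
      g \<in> smooth_functions Y Q \<Longrightarrow> (\<lambda>y\<in>Y. op (f y) (g y)) \<in> smooth_functions Y Q"
    and "(B, g) \<in> local_functions X P x" "(B', h) \<in> local_functions X P x"
  shows "(B \<inter> B', \<lambda>y\<in>B \<inter> B'. op (g y) (h y)) \<in> local_functions X P x"
proof -
  let ?Q = "subdiffeology P (B \<inter> B')"
  have Q: "?Q \<subseteq> parametrizations (B \<inter> B')" "?Q \<subseteq> subdiffeology P B" "?Q \<subseteq> subdiffeology P B'"
    by (auto simp: subdiffeology_def parametrizations_def)
  have "g \<in> smooth_functions B (subdiffeology P B)" "h \<in> smooth_functions B' (subdiffeology P B')"
    using assms(2,3) by (simp_all add: local_functions_def)
  moreover have "subdiffeology P B \<subseteq> parametrizations B" "subdiffeology P B' \<subseteq> parametrizations B'"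
    by (simp_all add: subdiffeology_def)
  ultimately have "restrict g (B \<inter> B') \<in> smooth_functions (B \<inter> B') ?Q"
    "restrict h (B \<inter> B') \<in> smooth_functions (B \<inter> B') ?Q"
    using Q by (blast intro: smooth_functions_restrict)+
  from op[OF Q(1) this]
  have "(\<lambda>y\<in>B \<inter> B'. op (restrict g (B \<inter> B') y) (restrict h (B \<inter> B') y)) \<in>
      smooth_functions (B \<inter> B') ?Q" .
  also have "(\<lambda>y\<in>B \<inter> B'. op (restrict g (B \<inter> B') y) (restrict h (B \<inter> B') y)) =
      (\<lambda>y\<in>B \<inter> B'. op (g y) (h y))"
    by (rule restrict_ext) simp
  finally have "(\<lambda>y\<in>B \<inter> B'. op (g y) (h y)) \<in> smooth_functions (B \<inter> B') ?Q" .
  moreover have "openin (D_topology X P) (B \<inter> B')" "x \<in> B \<inter> B'"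
    using assms(2,3) by (auto simp: local_functions_def)
  ultimately show ?thesis
    unfolding local_functions_def by blast
qed

text \<open>If representatives are exchanged with agreement on \<open>V\<close> and
  \<open>W\<close>, the results agree on \<open>V \<inter> W\<close>. Every member of the double
  union is therefore the same class.\<close>

lemma germ_binop:
  fixes X :: "'a set"
  assumes op: "\<And>Q (Y :: 'a set) f g. Q \<subseteq> parametrizations Y \<Longrightarrow> f \<in> smooth_functions Y Q \<Longrightarrow>
      g \<in> smooth_functions Y Q \<Longrightarrow> (\<lambda>y\<in>Y. op (f y) (g y)) \<in> smooth_functions Y Q"
    and g: "(B, g) \<in> local_functions X P x" and h: "(B', h) \<in> local_functions X P x"
  shows "(\<Union>(B, g)\<in>germ X P x B g. \<Union>(B', h)\<in>germ X P x B' h.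
      germ X P x (B \<inter> B') (\<lambda>y\<in>B \<inter> B'. op (g y) (h y))) =
    germ X P x (B \<inter> B') (\<lambda>y\<in>B \<inter> B'. op (g y) (h y))"
proof -
  have "germ X P x (C \<inter> C') (\<lambda>y\<in>C \<inter> C'. op (k y) (l y)) =
      germ X P x (B \<inter> B') (\<lambda>y\<in>B \<inter> B'. op (g y) (h y))"
    if "(C, k) \<in> germ X P x B g" "(C', l) \<in> germ X P x B' h" for C k C' l
  proof -
    have rel: "((B, g), (C, k)) \<in> germ_rel X P x" "((B', h), (C', l)) \<in> germ_rel X P x"
      using that by (simp_all add: mem_germ_iff)
    obtain V where V: "openin (D_topology X P) V" "x \<in> V" "V \<subseteq> B \<inter> C" "\<forall>y\<in>V. g y = k y"
      using rel(1) by (auto simp: germ_rel_def)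
    obtain W where W: "openin (D_topology X P) W" "x \<in> W" "W \<subseteq> B' \<inter> C'" "\<forall>y\<in>W. h y = l y"
      using rel(2) by (auto simp: germ_rel_def)
    have loc: "(C \<inter> C', \<lambda>y\<in>C \<inter> C'. op (k y) (l y)) \<in> local_functions X P x"
      "(B \<inter> B', \<lambda>y\<in>B \<inter> B'. op (g y) (h y)) \<in> local_functions X P x"
      by ((rule local_functions_binop[OF _ germ_relD(2)[OF rel(1)] germ_relD(2)[OF rel(2)]]
            local_functions_binop[OF _ g h]), erule (2) op)+
    have "openin (D_topology X P) (V \<inter> W)" "x \<in> V \<inter> W" "V \<inter> W \<subseteq> (C \<inter> C') \<inter> (B \<inter> B')"
      "\<forall>y\<in>V \<inter> W. (\<lambda>y\<in>C \<inter> C'. op (k y) (l y)) y = (\<lambda>y\<in>B \<inter> B'. op (g y) (h y)) y"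
      using V W by auto
    then show ?thesis
      unfolding germ_eq_iff[OF loc] using loc unfolding germ_rel_def by blast
  qed
  \<comment> \<open>The index classes are nonempty by \<open>germ_self_mem\<close>, so the union of
    equal sets is that set.\<close>
  then show ?thesis
    using germ_self_mem[OF g] germ_self_mem[OF h] by fast
qed

lemma germ_smult:
  assumes g: "(B, g) \<in> local_functions X P x"
  shows "(\<Union>(B, g)\<in>germ X P x B g. germ X P x B (\<lambda>y\<in>B. c * g y)) = germ X P x B (\<lambda>y\<in>B. c * g y)"
proof -
  have loc: "(C, \<lambda>y\<in>C. c * k y) \<in> local_functions X P x" if "(C, k) \<in> local_functions X P x" for C k
    using that by (auto simp: local_functions_def subdiffeology_def intro!: smooth_functions_cmult)
  have "germ X P x C (\<lambda>y\<in>C. c * k y) = germ X P x B (\<lambda>y\<in>B. c * g y)"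
    if "(C, k) \<in> germ X P x B g" for C k
  proof -
    have rel: "((B, g), (C, k)) \<in> germ_rel X P x"
      using that by (simp add: mem_germ_iff)
    obtain V where V: "openin (D_topology X P) V" "x \<in> V" "V \<subseteq> B \<inter> C" "\<forall>y\<in>V. g y = k y"
      using rel by (auto simp: germ_rel_def)
    have "V \<subseteq> C \<inter> B" "\<forall>y\<in>V. (\<lambda>y\<in>C. c * k y) y = (\<lambda>y\<in>B. c * g y) y"
      using V by auto
    then show ?thesis
      unfolding germ_eq_iff[OF loc[OF germ_relD(2)[OF rel]] loc[OF g]]
      using V loc[OF germ_relD(2)[OF rel]] loc[OF g] unfolding germ_rel_def by blast
  qed
  then show ?thesis
    using germ_self_mem[OF g] by fast
qed

section \<open>Derivations\<close>

text \<open>The assumption \<open>local\<close> makes each derivation constant on the fibres of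
  \<open>r\<close>, so it descends to \<open>G\<close>. Pulling derivations on \<open>G\<close> back
  along \<open>r\<close> gives the inverse.\<close>

lemma derivation_space_iso:
  fixes A :: "(real, 'g) module" and G :: "(real, 'h) module"
  assumes surj: "r ` carrier A = carrier G"
    and closed: "\<And>a b. a \<in> carrier A \<Longrightarrow> b \<in> carrier A \<Longrightarrow> a \<oplus>\<^bsub>A\<^esub> b \<in> carrier A"
      "\<And>a b. a \<in> carrier A \<Longrightarrow> b \<in> carrier A \<Longrightarrow> a \<otimes>\<^bsub>A\<^esub> b \<in> carrier A"
      "\<And>c a. a \<in> carrier A \<Longrightarrow> c \<odot>\<^bsub>A\<^esub> a \<in> carrier A"
    and hom: "\<And>a b. a \<in> carrier A \<Longrightarrow> b \<in> carrier A \<Longrightarrow> r (a \<oplus>\<^bsub>A\<^esub> b) = r a \<oplus>\<^bsub>G\<^esub> r b"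
      "\<And>a b. a \<in> carrier A \<Longrightarrow> b \<in> carrier A \<Longrightarrow> r (a \<otimes>\<^bsub>A\<^esub> b) = r a \<otimes>\<^bsub>G\<^esub> r b"
      "\<And>c a. a \<in> carrier A \<Longrightarrow> r (c \<odot>\<^bsub>A\<^esub> a) = c \<odot>\<^bsub>G\<^esub> r a"
    and ev: "\<And>a. a \<in> carrier A \<Longrightarrow> ev' (r a) = ev a"
    and local: "\<And>a b. a \<in> carrier A \<Longrightarrow> b \<in> carrier A \<Longrightarrow> r a = r b \<Longrightarrow>
      \<exists>l\<in>carrier A. ev l = 1 \<and> l \<otimes>\<^bsub>A\<^esub> a = l \<otimes>\<^bsub>A\<^esub> b"
  shows "\<exists>\<phi>. \<phi> \<in> module_iso real_ring (derivation_space A ev) (derivation_space G ev')"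
proof -
  let ?V = "derivation_space A ev" and ?W = "derivation_space G ev'"
  \<comment> \<open>An arbitrary choice of preimages serves to define \<phi>; the fact
    \<open>eq\<close> below shows that the choice does not affect the values on derivations.\<close>
  define s where "s = inv_into (carrier A) r"
  define \<phi> where "\<phi> D = (\<lambda>c\<in>carrier G. D (s c))" for D :: "'g \<Rightarrow> real"
  have s: "s c \<in> carrier A" "r (s c) = c" if "c \<in> carrier G" for c
    using that surj by (auto simp: s_def inv_into_into f_inv_into_f)
  have r: "r a \<in> carrier G" if "a \<in> carrier A" for a
    using that surj by blast
  have eq: "D a = D b" if D: "D \<in> carrier ?V" and ab: "a \<in> carrier A" "b \<in> carrier A" "r a = r b" for D a b
  proof -
    obtain l where l: "l \<in> carrier A" "ev l = 1" "l \<otimes>\<^bsub>A\<^esub> a = l \<otimes>\<^bsub>A\<^esub> b"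
      using local[OF ab] by blast
    have "D (l \<otimes>\<^bsub>A\<^esub> c) = ev l * D c + ev c * D l" if "c \<in> carrier A" for c
      using D l(1) that by (simp add: derivation_space_def)
    from this[OF ab(1)] this[OF ab(2)]
    have "ev l * D a + ev a * D l = ev l * D b + ev b * D l"
      using l(3) by simp
    \<comment> \<open>The evaluation factors through \<open>r\<close>, so the terms with
      \<open>D l\<close> cancel and \<open>ev l = 1\<close> leaves \<open>D a = D b\<close>.\<close>
    moreover have "ev a = ev b"
      using ev[OF ab(1)] ev[OF ab(2)] ab(3) by simp
    ultimately show ?thesis
      using l by simp
  qed
  have \<phi>r: "\<phi> D (r a) = D a" if "D \<in> carrier ?V" "a \<in> carrier A" for D a
    using eq[OF that(1) s(1)[OF r] that(2) s(2)[OF r]] that r by (simp add: \<phi>_def)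
  have all_r: "(\<forall>c\<in>carrier G. Q c) \<longleftrightarrow> (\<forall>a\<in>carrier A. Q (r a))" for Q
    by (simp flip: surj)
  have \<phi>_closed: "\<phi> D \<in> carrier ?W" if D: "D \<in> carrier ?V" for D
  proof -
    have "\<phi> D \<in> carrier G \<rightarrow>\<^sub>E UNIV" by (simp add: \<phi>_def)
    moreover have "\<phi> D (r a \<oplus>\<^bsub>G\<^esub> r b) = \<phi> D (r a) + \<phi> D (r b)"
      "\<phi> D (c \<odot>\<^bsub>G\<^esub> r a) = c * \<phi> D (r a)"
      "\<phi> D (r a \<otimes>\<^bsub>G\<^esub> r b) = ev' (r a) * \<phi> D (r b) + ev' (r b) * \<phi> D (r a)"
      if "a \<in> carrier A" "b \<in> carrier A" for a b c
      \<comment> \<open>Reading \<open>hom\<close> backwards turns an operation on images into the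
        image of an operation in \<open>A\<close>, where \<open>\<phi>r\<close> returns the value of
        \<open>D\<close>.\<close>
      using D that closed by (simp_all add: hom[symmetric] \<phi>r ev) (simp_all add: derivation_space_def)
    ultimately show ?thesis
      by (simp add: derivation_space_def all_r)
  qed
  have "inj_on \<phi> (carrier ?V)"
  proof (rule inj_onI)
    fix D E assume DE: "D \<in> carrier ?V" "E \<in> carrier ?V" "\<phi> D = \<phi> E"
    show "D = E"
    proof (rule PiE_ext)
      show "D \<in> carrier A \<rightarrow>\<^sub>E UNIV" "E \<in> carrier A \<rightarrow>\<^sub>E UNIV"
        using DE by (simp_all add: derivation_space_def)
      show "D a = E a" if "a \<in> carrier A" for a
        using \<phi>r[OF DE(1) that] \<phi>r[OF DE(2) that] DE(3) by simp
    qed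
  qed
  moreover have "\<phi> ` carrier ?V = carrier ?W"
  proof (intro equalityI subsetI)
    fix E assume E: "E \<in> carrier ?W"
    let ?D = "\<lambda>a\<in>carrier A. E (r a)"
    have "?D \<in> carrier ?V"
      using E closed r by (simp add: derivation_space_def hom ev)
    moreover have "\<phi> ?D = E"
    proof (rule PiE_ext)
      show "\<phi> ?D \<in> carrier G \<rightarrow>\<^sub>E UNIV" "E \<in> carrier G \<rightarrow>\<^sub>E UNIV"
        using E by (simp_all add: \<phi>_def derivation_space_def)
      show "\<phi> ?D c = E c" if "c \<in> carrier G" for c
        using that s by (simp add: \<phi>_def)
    qed
    ultimately show "E \<in> \<phi> ` carrier ?V"
      using imageI[of ?D "carrier ?V" \<phi>] by (simp only:)
  qed (use \<phi>_closed in blast)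
  moreover have "\<phi> (D \<oplus>\<^bsub>?V\<^esub> E) = \<phi> D \<oplus>\<^bsub>?W\<^esub> \<phi> E" for D E
    using s by (auto simp: \<phi>_def derivation_space_def)
  moreover have "\<phi> (c \<odot>\<^bsub>?V\<^esub> D) = c \<odot>\<^bsub>?W\<^esub> \<phi> D" for c D
    using s by (auto simp: \<phi>_def derivation_space_def)
  ultimately have "\<phi> \<in> module_iso real_ring ?V ?W"
    using \<phi>_closed by (auto simp: module_iso_def iso_def hom_def bij_betw_def)
  then show ?thesis by blast
qed

theorem theorem4p25:
  fixes X :: "'a set" and P :: "'a parametrization set" and x :: 'a
  assumes "diffeological_space X P"
    and "x \<in> X"
    and "smoothly_regular_at X P x"
  shows "\<exists>\<phi>. \<phi> \<in> module_iso real_ring (global_right_tangent_space X P x) (right_tangent_space X P x)"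
proof -
  interpret diffeological_space X P by fact
  let ?A = "smooth_algebra X P" and ?G = "germ_algebra X P x" and ?r = "germ X P x X"
  \<comment> \<open>This identifies global smooth functions with local functions on the
    neighbourhood \<open>X\<close>, so that \<open>?r\<close> is defined on them.\<close>
  have "subdiffeology P X = P"
    using plots_subset by (auto simp: subdiffeology_def)
  moreover have "openin (D_topology X P) X"
    using openin_topspace[of "D_topology X P"] topspace_D_topology[OF plots_subset] by simp
  ultimately have loc: "(X, f) \<in> local_functions X P x" if "f \<in> smooth_functions X P" for f
    using that \<open>x \<in> X\<close> by (simp add: local_functions_def)
  show ?thesis
    unfolding global_right_tangent_space_def right_tangent_space_def
  proof (rule derivation_space_iso[where r = ?r])
    show "?r ` carrier ?A = carrier ?G"
    proof (intro equalityI subsetI)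
      fix c assume "c \<in> ?r ` carrier ?A"
      then show "c \<in> carrier ?G"
        using loc by (auto simp: smooth_algebra_def germ_algebra_def germ_def intro: quotientI)
    next
      fix c assume "c \<in> carrier ?G"
      then obtain B g where Bg: "(B, g) \<in> local_functions X P x" "c = germ X P x B g"
        by (auto simp: germ_algebra_def germ_def elim!: quotientE)
      have B: "openin (D_topology X P) B" "x \<in> B" "g \<in> smooth_functions B (subdiffeology P B)"
        using Bg(1) by (auto simp: local_functions_def)
      have BX: "B \<subseteq> X"
        using openin_subset[OF B(1)] topspace_D_topology[OF plots_subset] by simp
      obtain m C W where m: "m \<in> smooth_functions X P"
        and C: "openin (D_topology X P) C" "B \<union> C = X" "\<And>y. y \<in> C \<Longrightarrow> m y = 0"
        and W: "openin (D_topology X P) W" "x \<in> W" "W \<subseteq> B" "\<And>y. y \<in> W \<Longrightarrow> m y = 1"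
        using smooth_cutoff[OF assms(3) B(1,2)] by blast
      \<comment> \<open>Multiplying by \<open>m\<close> allows extension by zero to all of
        \<open>X\<close> and leaves \<open>g\<close> unchanged on \<open>W\<close>, hence keeps its
        germ.\<close>
      define f where "f = (\<lambda>y\<in>X. if y \<in> B then m y * g y else 0)"
      have f: "f \<in> smooth_functions X P"
        unfolding f_def by (rule smooth_extension_by_zero[OF B(1,3) m C])
      have "W \<subseteq> B \<inter> X" "\<forall>y\<in>W. g y = f y"
        using W BX by (auto simp: f_def)
      then have "germ X P x B g = ?r f"
        unfolding germ_eq_iff[OF Bg(1) loc[OF f]]
        using W(1,2) Bg(1) loc[OF f] unfolding germ_rel_def by blast
      then show "c \<in> ?r ` carrier ?A"
        using f Bg(2) by (simp add: smooth_algebra_def)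
    qed
  next
    fix a b assume ab: "a \<in> carrier ?A" "b \<in> carrier ?A"
    show "a \<oplus>\<^bsub>?A\<^esub> b \<in> carrier ?A" "a \<otimes>\<^bsub>?A\<^esub> b \<in> carrier ?A"
      using ab plots_subset by (simp_all add: smooth_algebra_def smooth_functions_add smooth_functions_mult)
    have loc_ab: "(X, a) \<in> local_functions X P x" "(X, b) \<in> local_functions X P x"
      using ab loc by (simp_all add: smooth_algebra_def)
    have "(\<Union>(B, g)\<in>?r a. \<Union>(B', h)\<in>?r b.
        germ X P x (B \<inter> B') (\<lambda>y\<in>B \<inter> B'. g y + h y)) =
        germ X P x (X \<inter> X) (\<lambda>y\<in>X \<inter> X. a y + b y)"
      by (rule germ_binop[where op = "(+)", OF _ loc_ab]) (rule smooth_functions_add)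
    then show "?r (a \<oplus>\<^bsub>?A\<^esub> b) = ?r a \<oplus>\<^bsub>?G\<^esub> ?r b"
      by (simp add: smooth_algebra_def germ_algebra_def)
    have "(\<Union>(B, g)\<in>?r a. \<Union>(B', h)\<in>?r b.
        germ X P x (B \<inter> B') (\<lambda>y\<in>B \<inter> B'. g y * h y)) =
        germ X P x (X \<inter> X) (\<lambda>y\<in>X \<inter> X. a y * b y)"
      by (rule germ_binop[where op = "(*)", OF _ loc_ab]) (rule smooth_functions_mult)
    then show "?r (a \<otimes>\<^bsub>?A\<^esub> b) = ?r a \<otimes>\<^bsub>?G\<^esub> ?r b"
      by (simp add: smooth_algebra_def germ_algebra_def)
    show "\<exists>l\<in>carrier ?A. l x = 1 \<and> l \<otimes>\<^bsub>?A\<^esub> a = l \<otimes>\<^bsub>?A\<^esub> b" if eq: "?r a = ?r b"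
    proof -
      have "((X, a), (X, b)) \<in> germ_rel X P x"
        using eq germ_eq_iff[OF loc_ab] by simp
      then obtain W where W: "openin (D_topology X P) W" "x \<in> W" "\<forall>y\<in>W. a y = b y"
        by (auto simp: germ_rel_def)
      \<comment> \<open>Regularity is applied to the set \<open>W\<close> of agreement: off
        \<open>W\<close> both products with \<open>l\<close> vanish, on \<open>W\<close> the factors
        \<open>a\<close> and \<open>b\<close> coincide.\<close>
      obtain l where "l \<in> smooth_functions X P" "l x = 1" "\<forall>y\<in>X - W. l y = 0"
        by (rule smoothly_regularE[OF assms(3) W(1,2)])
      moreover from this W(3) have "(\<lambda>y\<in>X. l y * a y) = (\<lambda>y\<in>X. l y * b y)"
        by (intro restrict_ext) (metis DiffI mult_zero_left)
      ultimately show ?thesis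
        by (auto simp: smooth_algebra_def)
    qed
  next
    fix a c assume a: "a \<in> carrier ?A"
    show "c \<odot>\<^bsub>?A\<^esub> a \<in> carrier ?A"
      using a plots_subset by (simp add: smooth_algebra_def smooth_functions_cmult)
    show "?r (c \<odot>\<^bsub>?A\<^esub> a) = c \<odot>\<^bsub>?G\<^esub> ?r a"
      using a germ_smult[OF loc, of a c] by (simp add: smooth_algebra_def germ_algebra_def)
  next
    fix a assume "a \<in> carrier ?A"
    then show "germ_value x (?r a) = a x"
      using germ_value_germ[OF loc] by (simp add: smooth_algebra_def)
  qed
qed

end
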